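(* Let $q\ge 8$ be an integer with $q\equiv 0$ or $q\equiv 1\pmod 4$, and let $\ell=\binom{q}{2}$. For every integer $k\ge 1$ and $n=(\ell+2)^k$, there exists a completely balanced edge-coloring of $K_n$ with $\ell+1$ colors that contains no rainbow $K_q$.
   Context: $K_n$ denotes the complete graph on $n$ vertices. An edge-coloring of $K_n$ using a set $C$ of $t$ colors, where $t$ divides $n-1$, is completely balanced if every vertex is incident to exactly $(n-1)/t$ edges of each color of $C$. A subgraph is rainbow if all its edges receive distinct colors. *)

theory Defs
  imports "HOL-Library.Ramsey"
begin

text \<open>The complete graph on a vertex set \<open>V\<close> has the edge set \<open>[V]\<^bsup>2\<^esup>\<close> of
  two-element subsets of \<open>V\<close>; its subgraphs isomorphic to \<open>K\<^sub>q\<close> correspond exactly to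
  the vertex sets in \<open>[V]\<^bsup>q\<^esup>\<close>.\<close>

definition edge_coloring :: "'a set \<Rightarrow> 'c set \<Rightarrow> ('a set \<Rightarrow> 'c) \<Rightarrow> bool" where
  "edge_coloring V C c \<longleftrightarrow> c \<in> [V]\<^bsup>2\<^esup> \<rightarrow> C"

definition completely_balanced :: "'a set \<Rightarrow> 'c set \<Rightarrow> ('a set \<Rightarrow> 'c) \<Rightarrow> bool" where
  "completely_balanced V C c \<longleftrightarrow>
     finite V \<and> finite C \<and> edge_coloring V C c \<and> card C dvd card V - 1 \<and>
     (\<forall>v\<in>V. \<forall>i\<in>C. card {e \<in> [V]\<^bsup>2\<^esup>. v \<in> e \<and> c e = i} = (card V - 1) div card C)"

definition rainbow :: "('a set \<Rightarrow> 'c) \<Rightarrow> 'a set set \<Rightarrow> bool" where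
  "rainbow c E \<longleftrightarrow> inj_on c E"

definition has_rainbow_clique :: "'a set \<Rightarrow> ('a set \<Rightarrow> 'c) \<Rightarrow> nat \<Rightarrow> bool" where
  "has_rainbow_clique V c q \<longleftrightarrow> (\<exists>S\<in>[V]\<^bsup>q\<^esup>. rainbow c ([S]\<^bsup>2\<^esup>))"

end

theory Submission
  imports Defs "HOL-Number_Theory.Cong"
begin

text \<open>
  Put \<open>M = l + 1\<close>, which is odd. Colour the complete graph on \<open>\<int>\<^sub>M \<union> {\<infinity>}\<close> by giving \<open>{x, y}\<close>
  the colour \<open>x + y\<close> and \<open>{x, \<infinity>}\<close> the colour \<open>2x\<close>; this is a 1-factorization. In a rainbow
  clique, an equality \<open>a - b = c - d\<close> of differences of distinct finite vertices means
  \<open>a + d = b + c\<close>, so it can occur only for three-term progressions (\<open>a = d\<close> or \<open>b = c\<close>), of which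
  there is at most one for each middle term, and none at all if \<open>\<infinity>\<close> is in the clique. Hence a
  rainbow \<open>K\<^sub>q\<close> has at least \<open>q(q - 3)\<close>, respectively \<open>(q - 1)(q - 2)\<close>, distinct differences,
  more than the \<open>M = q(q - 1)/2 + 1\<close> residues available. For higher powers iterate the lexicographic
  product: a rainbow clique with at least three vertices either meets every block at most once
  or lies inside a single block.
\<close>

text \<open>Edges are encoded as ordered pairs, which suits vertex arithmetic. Symmetry is global,
  so it can be used without range conditions; \<open>d\<close> is the common degree of all
  colours.\<close>

definition regular_coloring :: "nat \<Rightarrow> nat \<Rightarrow> nat \<Rightarrow> (nat \<Rightarrow> nat \<Rightarrow> nat) \<Rightarrow> bool" where
  "regular_coloring m t d f \<longleftrightarrow>
     (\<forall>u v. f u v = f v u) \<and> (\<forall>u<m. \<forall>v<m. u \<noteq> v \<longrightarrow> f u v < t) \<and>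
     (\<forall>v<m. \<forall>i<t. card {u. u < m \<and> u \<noteq> v \<and> f v u = i} = d)"

definition rainbow_on :: "(nat \<Rightarrow> nat \<Rightarrow> nat) \<Rightarrow> nat set \<Rightarrow> bool" where
  "rainbow_on f S \<longleftrightarrow>
     (\<forall>a\<in>S. \<forall>b\<in>S. \<forall>c\<in>S. \<forall>d\<in>S. a \<noteq> b \<longrightarrow> c \<noteq> d \<longrightarrow> f a b = f c d \<longrightarrow> {a, b} = {c, d})"

lemma rainbow_onD:
  "\<lbrakk>rainbow_on f S; f a b = f c d; a \<in> S; b \<in> S; c \<in> S; d \<in> S; a \<noteq> b; c \<noteq> d\<rbrakk>
    \<Longrightarrow> {a, b} = {c, d}"
  unfolding rainbow_on_def by blast

section \<open>From symmetric functions to edge colorings\<close>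

lemma completely_balanced_of_regular_coloring:
  assumes f: "regular_coloring m t d f" and "m = t * d + 1" "t > 0"
    and no: "\<And>S. S \<subseteq> {..<m} \<Longrightarrow> card S = q \<Longrightarrow> finite S \<Longrightarrow> \<not> rainbow_on f S"
  shows "\<exists>c. completely_balanced {..<m} {..<t} c \<and> \<not> has_rainbow_clique {..<m} c q"
proof -
  \<comment> \<open>\<open>Min\<close> and \<open>Max\<close> recover the two endpoints; by symmetry
    of \<open>f\<close> their order is immaterial.\<close>
  define c where "c e = f (Min e) (Max e)" for e
  have sym: "f u v = f v u" for u v using f unfolding regular_coloring_def by blast
  have c: "c {u, v} = f u v" for u v
    unfolding c_def by (cases "u \<le> v") (simp_all add: sym min_def max_def)
  have "c \<in> [{..<m}]\<^bsup>2\<^esup> \<rightarrow> {..<t}"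
  proof
    fix e assume "e \<in> [{..<m}]\<^bsup>2\<^esup>"
    then obtain u v where "e = {u, v}" "u \<noteq> v" "u < m" "v < m"
      unfolding nsets_def card_2_iff by auto
    then show "c e \<in> {..<t}" using f c unfolding regular_coloring_def by auto
  qed
  moreover have "card {e \<in> [{..<m}]\<^bsup>2\<^esup>. v \<in> e \<and> c e = i} = d" if "v < m" "i < t" for v i
  proof -
    have "{e \<in> [{..<m}]\<^bsup>2\<^esup>. v \<in> e \<and> c e = i} =
          (\<lambda>u. {v, u}) ` {u. u < m \<and> u \<noteq> v \<and> f v u = i}" (is "?L = ?R")
    proof
      show "?R \<subseteq> ?L" using that c by (auto simp: nsets_def card_2_iff)
      show "?L \<subseteq> ?R"
      proof
        fix e assume e: "e \<in> ?L"
        then obtain x y where xy: "e = {x, y}" "x \<noteq> y" unfolding nsets_def card_2_iff by auto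
        with e obtain u where "e = {v, u}" "u \<noteq> v" by auto
        with e c show "e \<in> ?R" by (auto simp: nsets_def)
      qed
    qed
    moreover have "inj_on (\<lambda>u. {v, u}) A" for A
      by (auto simp: inj_on_def doubleton_eq_iff)
    moreover have "card {u. u < m \<and> u \<noteq> v \<and> f v u = i} = d"
      using f that unfolding regular_coloring_def by blast
    ultimately show ?thesis by (simp only: card_image)
  qed
  ultimately have "completely_balanced {..<m} {..<t} c"
    unfolding completely_balanced_def edge_coloring_def using assms by simp
  moreover have "\<not> has_rainbow_clique {..<m} c q"
  proof
    assume "has_rainbow_clique {..<m} c q"
    then obtain S where S: "S \<in> [{..<m}]\<^bsup>q\<^esup>" "inj_on c ([S]\<^bsup>2\<^esup>)"
      unfolding has_rainbow_clique_def rainbow_def by blast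
    have "rainbow_on f S"
      unfolding rainbow_on_def
    proof (intro ballI impI)
      fix x y z w assume *: "x \<in> S" "y \<in> S" "z \<in> S" "w \<in> S" "x \<noteq> y" "z \<noteq> w" "f x y = f z w"
      then have "{x, y} \<in> [S]\<^bsup>2\<^esup>" "{z, w} \<in> [S]\<^bsup>2\<^esup>" "c {x, y} = c {z, w}"
        by (auto simp: nsets_def c)
      then show "{x, y} = {z, w}" using S(2) by (metis inj_onD)
    qed
    then show False using no S(1) by (auto simp: nsets_def)
  qed
  ultimately show ?thesis by blast
qed

section \<open>The lexicographic product\<close>

definition lex_coloring ::
    "nat \<Rightarrow> (nat \<Rightarrow> nat \<Rightarrow> nat) \<Rightarrow> (nat \<Rightarrow> nat \<Rightarrow> nat) \<Rightarrow> nat \<Rightarrow> nat \<Rightarrow> nat" where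
  "lex_coloring N g f x y =
     (if x div N = y div N then g (x mod N) (y mod N) else f (x div N) (y div N))"

lemma div_mod_eqI: "x div N = y div N \<Longrightarrow> x mod N = y mod N \<Longrightarrow> x = (y::nat)"
  by (metis div_mult_mod_eq)

text \<open>In a given colour, a vertex is joined to all \<open>N\<close> vertices of
  \<open>d\<close> other blocks and to \<open>e\<close> vertices of its own block.\<close>

lemma regular_coloring_lex:
  assumes f: "regular_coloring m t d f" and g: "regular_coloring N t e g" and N: "N > 0"
  shows "regular_coloring (m * N) t (d * N + e) (lex_coloring N g f)"
proof -
  have symf: "f u v = f v u" for u v using f unfolding regular_coloring_def by blast
  have symg: "g u v = g v u" for u v using g unfolding regular_coloring_def by blast
  have dlt: "x div N < m" if "x < m * N" for x using that by (simp add: less_mult_imp_div_less)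
  have "lex_coloring N g f u v = lex_coloring N g f v u" for u v
    unfolding lex_coloring_def using symf symg by simp
  moreover have "lex_coloring N g f u v < t" if "u < m * N" "v < m * N" "u \<noteq> v" for u v
  proof (cases "u div N = v div N")
    case True
    then have "u mod N \<noteq> v mod N" using that div_mod_eqI by blast
    then show ?thesis
      using g True N unfolding lex_coloring_def regular_coloring_def by simp
  next
    case False
    then show ?thesis
      using f that dlt unfolding lex_coloring_def regular_coloring_def by simp
  qed
  moreover have "card {u. u < m * N \<and> u \<noteq> v \<and> lex_coloring N g f v u = i} = d * N + e"
    if v: "v < m * N" and i: "i < t" for v i
  proof -
    define F where "F = {u. u < m \<and> u \<noteq> v div N \<and> f (v div N) u = i}"
    define G where "G = {u. u < N \<and> u \<noteq> v mod N \<and> g (v mod N) u = i}"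
    define U where "U = {u. u < m * N \<and> u \<noteq> v \<and> lex_coloring N g f v u = i}"
    have fin: "finite F" "finite G" unfolding F_def G_def by auto
    have "v div N < m" "v mod N < N" using dlt v N by auto
    then have cards: "card F = d" "card G = e"
      using f g i unfolding F_def G_def regular_coloring_def by blast+
    have "(\<lambda>u. (u div N, u mod N)) ` U = F \<times> {..<N} \<union> {v div N} \<times> G"
    proof
      show "(\<lambda>u. (u div N, u mod N)) ` U \<subseteq> F \<times> {..<N} \<union> {v div N} \<times> G"
      proof (rule image_subsetI)
        fix u assume u: "u \<in> U"
        moreover have "u mod N \<noteq> v mod N" if "u div N = v div N"
          using u that div_mod_eqI[of u N v] by (auto simp: U_def)
        ultimately show "(u div N, u mod N) \<in> F \<times> {..<N} \<union> {v div N} \<times> G"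
          using N dlt by (auto simp: U_def F_def G_def lex_coloring_def split: if_splits)
      qed
      show "F \<times> {..<N} \<union> {v div N} \<times> G \<subseteq> (\<lambda>u. (u div N, u mod N)) ` U"
      proof
        fix p assume p: "p \<in> F \<times> {..<N} \<union> {v div N} \<times> G"
        obtain a b where ab: "p = (a, b)" by (cases p)
        have "a < m" "b < N" using p ab v dlt by (auto simp: F_def G_def)
        have "a * N + b < Suc a * N" using \<open>b < N\<close> by simp
        also have "\<dots> \<le> m * N" using \<open>a < m\<close> by (intro mult_le_mono) auto
        finally have lt: "a * N + b < m * N" .
        have dm: "(a * N + b) div N = a" "(a * N + b) mod N = b" using \<open>b < N\<close> by auto
        have "a \<noteq> v div N \<or> b \<noteq> v mod N" using p by (auto simp: ab F_def G_def)
        then have "a * N + b \<noteq> v" using dm by metis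
        then have "a * N + b \<in> U"
          using p lt dm unfolding ab U_def F_def G_def lex_coloring_def by auto
        then show "p \<in> (\<lambda>u. (u div N, u mod N)) ` U" using dm ab by force
      qed
    qed
    moreover have "inj_on (\<lambda>u. (u div N, u mod N)) U"
      by (auto intro!: inj_onI elim: div_mod_eqI)
    ultimately have "card U = card (F \<times> {..<N} \<union> {v div N} \<times> G)"
      by (metis card_image)
    also have "\<dots> = card (F \<times> {..<N}) + card ({v div N} \<times> G)"
      using fin by (intro card_Un_disjoint) (auto simp: F_def)
    finally show ?thesis using cards by (simp add: U_def card_cartesian_product)
  qed
  ultimately show ?thesis unfolding regular_coloring_def by blast
qed

text \<open>A vertex outside a block sees all vertices of that block in one colour. So as soon as
  two vertices of a rainbow clique share a block, no vertex can lie outside it.\<close>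

lemma rainbow_on_lex:
  assumes S: "rainbow_on (lex_coloring N g f) S"
    and sym: "\<And>u v. f u v = f v u"
  shows "(inj_on (\<lambda>x. x div N) S \<and> rainbow_on f ((\<lambda>x. x div N) ` S)) \<or>
         (inj_on (\<lambda>x. x mod N) S \<and> rainbow_on g ((\<lambda>x. x mod N) ` S)) \<or> card S < 3"
proof (cases "inj_on (\<lambda>x. x div N) S")
  case True
  have "rainbow_on f ((\<lambda>x. x div N) ` S)"
    unfolding rainbow_on_def
  proof (clarify)
    fix a b c d assume *: "a \<in> S" "b \<in> S" "c \<in> S" "d \<in> S" "a div N \<noteq> b div N" "c div N \<noteq> d div N"
      "f (a div N) (b div N) = f (c div N) (d div N)"
    then have "{a, b} = {c, d}"
      by (intro rainbow_onD[OF S]) (auto simp: lex_coloring_def)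
    then show "{a div N, b div N} = {c div N, d div N}" by (auto simp: doubleton_eq_iff)
  qed
  with True show ?thesis by blast
next
  case False
  then obtain x y where xy: "x \<in> S" "y \<in> S" "x \<noteq> y" "x div N = y div N"
    unfolding inj_on_def by blast
  have same: "z div N = x div N" if "z \<in> S" for z
  proof (rule ccontr)
    assume z: "z div N \<noteq> x div N"
    then have "{x, z} = {y, z}"
      using xy that by (intro rainbow_onD[OF S]) (auto simp: lex_coloring_def)
    then show False using xy z by (auto simp: doubleton_eq_iff)
  qed
  have inj: "inj_on (\<lambda>x. x mod N) S"
    by (rule inj_onI) (metis same div_mod_eqI)
  have "rainbow_on g ((\<lambda>x. x mod N) ` S)"
    unfolding rainbow_on_def
  proof (clarify)
    fix a b c d assume *: "a \<in> S" "b \<in> S" "c \<in> S" "d \<in> S" "a mod N \<noteq> b mod N" "c mod N \<noteq> d mod N"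
      "g (a mod N) (b mod N) = g (c mod N) (d mod N)"
    then have "{a, b} = {c, d}"
      using same[OF *(1)] same[OF *(2)] same[OF *(3)] same[OF *(4)]
      by (intro rainbow_onD[OF S]) (auto simp: lex_coloring_def)
    then show "{a mod N, b mod N} = {c mod N, d mod N}" by (auto simp: doubleton_eq_iff)
  qed
  with inj show ?thesis by blast
qed

text \<open>Induction with the \<open>k\<close>-th power as outer factor and \<open>g\<close> inside
  the blocks: a rainbow \<open>q\<close>-clique would project injectively to one in a
  factor.\<close>

lemma regular_coloring_power:
  assumes g: "regular_coloring (t + 1) t 1 g" and "q \<ge> 3"
    and no: "\<And>S. S \<subseteq> {..<t + 1} \<Longrightarrow> card S = q \<Longrightarrow> finite S \<Longrightarrow> \<not> rainbow_on g S"
  shows "\<exists>d f. (t + 1) ^ k = t * d + 1 \<and> regular_coloring ((t + 1) ^ k) t d f \<and>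
           (\<forall>S. S \<subseteq> {..<(t + 1) ^ k} \<longrightarrow> card S = q \<longrightarrow> finite S \<longrightarrow> \<not> rainbow_on f S)"
proof (induction k)
  case 0
  have "regular_coloring 1 t 0 (\<lambda>_ _. 0)" by (auto simp: regular_coloring_def)
  moreover have "card S \<noteq> q" if "S \<subseteq> {..<1}" for S :: "nat set"
    using card_mono[OF _ that] \<open>q \<ge> 3\<close> by auto
  \<comment> \<open>A single vertex has no edges, so degree 0 and any symmetric function will
    do.\<close>
  ultimately show ?case by (intro exI[of _ 0] exI[of _ "\<lambda>_ _. 0"]) auto
next
  case (Suc k)
  define N where "N = t + 1"
  from Suc obtain d f where d: "N ^ k = t * d + 1" and f: "regular_coloring (N ^ k) t d f"
    and S: "\<And>S. S \<subseteq> {..<N ^ k} \<Longrightarrow> card S = q \<Longrightarrow> finite S \<Longrightarrow> \<not> rainbow_on f S"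
    unfolding N_def by blast
  have pow: "N ^ Suc k = N ^ k * N" by simp
  \<comment> \<open>With \<open>N = t + 1\<close>,
    \<open>(t * d + 1) * N = t * d * N + t + 1\<close>, which matches the degree of the
    product.\<close>
  have "N ^ Suc k = t * (d * N + 1) + 1"
    unfolding pow d by (simp add: N_def algebra_simps)
  moreover have "regular_coloring (N ^ Suc k) t (d * N + 1) (lex_coloring N g f)"
    unfolding pow using f g by (intro regular_coloring_lex) (auto simp: N_def)
  moreover have "\<not> rainbow_on (lex_coloring N g f) T"
    if T: "T \<subseteq> {..<N ^ Suc k}" "card T = q" "finite T" for T
  proof
    assume "rainbow_on (lex_coloring N g f) T"
    then consider "inj_on (\<lambda>x. x div N) T" "rainbow_on f ((\<lambda>x. x div N) ` T)"
      | "inj_on (\<lambda>x. x mod N) T" "rainbow_on g ((\<lambda>x. x mod N) ` T)"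
      using rainbow_on_lex[of N g f T] f T \<open>q \<ge> 3\<close> unfolding regular_coloring_def
      by fastforce
    then show False
    proof cases
      case 1
      have "(\<lambda>x. x div N) ` T \<subseteq> {..<N ^ k}"
        using T(1) unfolding pow by (auto simp: less_mult_imp_div_less)
      then show False using 1 S T by (auto simp: card_image)
    next
      case 2
      have "(\<lambda>x. x mod N) ` T \<subseteq> {..<t + 1}" by (auto simp: N_def)
      then show False using 2 no T by (auto simp: card_image)
    qed
  qed
  ultimately show ?case unfolding N_def by blast
qed

section \<open>The one-factorization\<close>

text \<open>The vertex \<open>M\<close> plays the role of \<open>\<infinity>\<close>.\<close>

definition sum_coloring :: "nat \<Rightarrow> nat \<Rightarrow> nat \<Rightarrow> nat" where
  "sum_coloring M x y = (if x = M then y + y else if y = M then x + x else x + y) mod M"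

lemma double_mod_eq_iff:
  fixes x y M :: nat
  assumes "odd M" "x < M" "y < M"
  shows "(x + x) mod M = (y + y) mod M \<longleftrightarrow> x = y"
proof -
  have "[2 * x = 2 * y] (mod M) \<longleftrightarrow> [x = y] (mod M)"
    using assms by (intro cong_mult_lcancel_nat) auto
  then show ?thesis using assms by (simp add: cong_def mult_2)
qed

lemma add_mod_eq_iff:
  fixes x y z M :: nat
  assumes "x < M" "y < M"
  shows "(z + x) mod M = (z + y) mod M \<longleftrightarrow> x = y"
  using cong_add_lcancel_nat[of z x y M] assms by (simp add: cong_def)

text \<open>At a finite \<open>v\<close>, the edges to finite vertices miss the colour
  \<open>2v\<close>, since \<open>v + x = 2v\<close> forces \<open>x = v\<close>; the edge to
  infinity takes it. At infinity the colours \<open>2x\<close> differ because 2 is invertible modulo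
  an odd \<open>M\<close>.\<close>

lemma inj_on_sum_coloring:
  assumes M: "odd M" and v: "v \<le> M"
  shows "inj_on (sum_coloring M v) ({..M} - {v})"
proof (rule inj_onI)
  fix x y assume "x \<in> {..M} - {v}" "y \<in> {..M} - {v}"
    and eq: "sum_coloring M v x = sum_coloring M v y"
  then have xy: "x \<le> M" "y \<le> M" "x \<noteq> v" "y \<noteq> v" by auto
  show "x = y"
  proof (cases "v = M")
    case True
    then show ?thesis
      using xy eq double_mod_eq_iff[OF M, of x y] by (auto simp: sum_coloring_def)
  next
    case False
    then show ?thesis
      using xy v eq add_mod_eq_iff[of x M y v] add_mod_eq_iff[of x M v v] add_mod_eq_iff[of v M y v]
      by (auto simp: sum_coloring_def split: if_splits)
  qed
qed

text \<open>Each vertex has \<open>M\<close> neighbours and there are \<open>M\<close> colours, so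
  injectivity at a vertex makes every colour occur exactly once there.\<close>

lemma regular_sum_coloring:
  assumes M: "odd M"
  shows "regular_coloring (M + 1) M 1 (sum_coloring M)"
proof -
  have pos: "M > 0" using M by (cases M) auto
  have "card {u. u < M + 1 \<and> u \<noteq> v \<and> sum_coloring M v u = i} = 1" if "v < M + 1" "i < M" for v i
  proof -
    have inj: "inj_on (sum_coloring M v) ({..M} - {v})"
      using inj_on_sum_coloring M that by simp
    have "sum_coloring M v ` ({..M} - {v}) = {..<M}"
    proof (rule card_subset_eq)
      show "sum_coloring M v ` ({..M} - {v}) \<subseteq> {..<M}" using pos by (auto simp: sum_coloring_def)
      show "card (sum_coloring M v ` ({..M} - {v})) = card {..<M}"
        using inj that by (simp add: card_image)
    qed simp
    then have "i \<in> sum_coloring M v ` ({..M} - {v})" using \<open>i < M\<close> by simp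
    then obtain u where u: "u \<in> {..M} - {v}" "sum_coloring M v u = i" by blast
    have "{u. u < M + 1 \<and> u \<noteq> v \<and> sum_coloring M v u = i} = {u}"
    proof
      show "{u. u < M + 1 \<and> u \<noteq> v \<and> sum_coloring M v u = i} \<subseteq> {u}"
      proof
        fix x assume "x \<in> {u. u < M + 1 \<and> u \<noteq> v \<and> sum_coloring M v u = i}"
        then have "x \<in> {..M} - {v}" "sum_coloring M v x = sum_coloring M v u" using u by auto
        then show "x \<in> {u}" using inj_onD[OF inj] u(1) by blast
      qed
    qed (use u in auto)
    then show ?thesis by simp
  qed
  moreover have "sum_coloring M u v = sum_coloring M v u" for u v
    by (simp add: sum_coloring_def add.commute)
  moreover have "sum_coloring M u v < M" for u v
    using pos by (simp add: sum_coloring_def)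
  ultimately show ?thesis unfolding regular_coloring_def by blast
qed

section \<open>Weak Sidon sets modulo M\<close>

text \<open>Weak Sidon sets in the integers modulo \<open>M\<close>: only sums of two distinct
  elements are compared, so three-term progressions may occur.\<close>

definition weak_sidon :: "nat \<Rightarrow> nat set \<Rightarrow> bool" where
  "weak_sidon M T \<longleftrightarrow> rainbow_on (\<lambda>a b. (a + b) mod M) T"

lemma weak_sidonD:
  "\<lbrakk>weak_sidon M T; (a + b) mod M = (c + d) mod M; a \<in> T; b \<in> T; c \<in> T; d \<in> T; a \<noteq> b; c \<noteq> d\<rbrakk>
    \<Longrightarrow> {a, b} = {c, d}"
  unfolding weak_sidon_def rainbow_on_def by blast

text \<open>The ends of the three-term progressions modulo \<open>M\<close> with middle term
  \<open>b\<close>; each progression contributes both its ends.\<close>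

definition progression_starts :: "nat \<Rightarrow> nat set \<Rightarrow> nat \<Rightarrow> nat set" where
  "progression_starts M T b = {a \<in> T. a \<noteq> b \<and> (\<exists>c\<in>T. c \<noteq> a \<and> (a + c) mod M = (b + b) mod M)}"

text \<open>All progressions with middle \<open>b\<close> have end sum \<open>2b\<close>, so the
  weak Sidon property gives them the same pair of ends.\<close>

lemma card_progression_starts:
  assumes "weak_sidon M T"
  shows "card (progression_starts M T b) \<le> 2"
proof (cases "progression_starts M T b = {}")
  case False
  then obtain a c where ac: "a \<in> T" "c \<in> T" "c \<noteq> a" "(a + c) mod M = (b + b) mod M"
    unfolding progression_starts_def by auto
  have "progression_starts M T b \<subseteq> {a, c}"
  proof
    fix x assume "x \<in> progression_starts M T b"
    then obtain y where y: "x \<in> T" "y \<in> T" "y \<noteq> x" "(x + y) mod M = (b + b) mod M"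
      unfolding progression_starts_def by auto
    with ac have "{x, y} = {a, c}"
      using assms by (intro weak_sidonD) auto
    then show "x \<in> {a, c}" by auto
  qed
  then have "card (progression_starts M T b) \<le> card {a, c}" by (intro card_mono) auto
  also have "\<dots> \<le> 2" using ac by simp
  finally show ?thesis .
qed simp

text \<open>The differences \<open>a - b\<close> with \<open>a\<close> not in
  \<open>progression_starts M T b\<close> are pairwise distinct modulo \<open>M\<close>, and each
  \<open>b\<close> leaves at least \<open>card T - 1 - p\<close> choices of
  \<open>a\<close>.\<close>

lemma weak_sidon_card_bound:
  assumes M: "odd M" and T: "T \<subseteq> {..<M}" and ws: "weak_sidon M T"
    and p: "\<And>b. b \<in> T \<Longrightarrow> card (progression_starts M T b) \<le> p"
  shows "card T * (card T - 1 - p) \<le> M"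
proof -
  have fin: "finite T" using T finite_subset by blast
  define P where "P = (SIGMA b:T. T - {b} - progression_starts M T b)"
  \<comment> \<open>Integers avoid truncated subtraction; the pair starts with \<open>b\<close>
    because the excluded values of \<open>a\<close> depend on it.\<close>
  define diff where "diff = (\<lambda>(b, a). (int a - int b) mod int M)"
  have "inj_on diff P"
  proof (rule inj_onI, clarify)
    fix b a d c assume P: "(b, a) \<in> P" "(d, c) \<in> P" and "diff (b, a) = diff (d, c)"
    then have "(int a + int d) mod int M = (int b + int c) mod int M"
      unfolding diff_def by (simp add: mod_eq_dvd_iff algebra_simps)
    then have eq: "(a + d) mod M = (b + c) mod M"
      by (metis of_nat_add of_nat_eq_iff of_nat_mod)
    have in_T: "a \<in> T" "b \<in> T" "c \<in> T" "d \<in> T" "a \<noteq> b" "c \<noteq> d"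
      and n1: "a \<notin> progression_starts M T b" and n2: "c \<notin> progression_starts M T d"
      using P unfolding P_def by auto
    have lt: "a < M" "b < M" "c < M" "d < M" using in_T T by auto
    have "a \<noteq> d"
    proof
      assume "a = d"
      then have "(c + b) mod M = (d + d) mod M" using eq by (simp add: add.commute)
      \<comment> \<open>The ends of a progression must be distinct: \<open>b = c\<close> would give
        \<open>2c = 2d\<close>, hence \<open>c = d\<close> as \<open>M\<close> is odd.\<close>
      moreover from this have "b \<noteq> c"
        using double_mod_eq_iff[OF M, of c d] lt in_T by auto
      ultimately show False using n2 in_T unfolding progression_starts_def by auto
    qed
    moreover have "b \<noteq> c"
    proof
      assume "b = c"
      then have "(a + d) mod M = (b + b) mod M" using eq by simp
      then show False using n1 in_T \<open>a \<noteq> d\<close> unfolding progression_starts_def by auto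
    qed
    ultimately have "{a, d} = {b, c}"
      using eq in_T ws by (intro weak_sidonD) auto
    then show "b = d \<and> a = c" using in_T by (auto simp: doubleton_eq_iff)
  qed
  moreover have "diff ` P \<subseteq> {0..<int M}"
    using M by (cases "M = 0") (auto simp: diff_def)
  ultimately have "card P \<le> card {0..<int M}" by (intro card_inj_on_le) auto
  moreover have "card T * (card T - 1 - p) \<le> card P"
  proof -
    have "card T - 1 - p \<le> card (T - {b} - progression_starts M T b)" if "b \<in> T" for b
    proof -
      have "finite (progression_starts M T b)"
        using fin by (simp add: progression_starts_def)
      then have "card (T - {b}) - card (progression_starts M T b)
                   \<le> card (T - {b} - progression_starts M T b)"
        by (rule diff_card_le_card_Diff)
      then show ?thesis using p[OF that] that fin by simp
    qed
    then have "(\<Sum>b\<in>T. card T - 1 - p) \<le> (\<Sum>b\<in>T. card (T - {b} - progression_starts M T b))"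
      by (rule sum_mono)
    then show ?thesis using fin by (simp add: P_def)
  qed
  ultimately show ?thesis by simp
qed

text \<open>The difference count gives \<open>q(q - 3) \<le> M\<close> without infinity and
  \<open>(q - 1)(q - 2) \<le> M\<close> with it. Doubled, these read \<open>q^2 - 5q \<le> 2\<close>
  and \<open>q^2 - 5q + 2 \<le> 0\<close>, both false for \<open>q \<ge> 6\<close>.\<close>

lemma no_rainbow_sum_coloring:
  assumes q: "q \<ge> 6" and M: "odd M" "2 * M = q * (q - 1) + 2"
    and S: "S \<subseteq> {..<M + 1}" "card S = q" "finite S"
  shows "\<not> rainbow_on (sum_coloring M) S"
proof
  assume r: "rainbow_on (sum_coloring M) S"
  define T where "T = S - {M}"
  have T: "T \<subseteq> {..<M}" using S unfolding T_def by (auto simp: less_Suc_eq)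
  have ws: "weak_sidon M T"
    unfolding weak_sidon_def rainbow_on_def
  proof (intro ballI impI)
    fix a b c d assume *: "a \<in> T" "b \<in> T" "c \<in> T" "d \<in> T" "a \<noteq> b" "c \<noteq> d"
      "(a + b) mod M = (c + d) mod M"
    then show "{a, b} = {c, d}"
      by (intro rainbow_onD[OF r]) (auto simp: T_def sum_coloring_def)
  qed
  \<comment> \<open>This substitution removes truncated subtraction and leaves polynomials in
    \<open>j\<close> with nonnegative coefficients to compare.\<close>
  obtain j where j: "q = j + 6" using q le_Suc_ex by (metis add.commute)
  show False
  proof (cases "M \<in> S")
    case False
    then have "card T = q" using S by (simp add: T_def)
    then have "q * (q - 1 - 2) \<le> M"
      using weak_sidon_card_bound[OF M(1) T ws card_progression_starts[OF ws]] by simp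
    then show False using M(2) unfolding j by (simp add: algebra_simps)
  next
    case True
    \<comment> \<open>For a progression with ends \<open>a\<close>, \<open>c\<close> and middle
      \<open>b\<close>, the edge \<open>{a, c}\<close> would share the colour \<open>2b\<close> with
      the edge from \<open>b\<close> to infinity.\<close>
    have "progression_starts M T b = {}" if "b \<in> T" for b
    proof (rule ccontr)
      assume "progression_starts M T b \<noteq> {}"
      then obtain a c where *: "a \<in> T" "c \<in> T" "c \<noteq> a" "(a + c) mod M = (b + b) mod M"
        unfolding progression_starts_def by auto
      then have "{a, c} = {b, M}"
        using True that by (intro rainbow_onD[OF r]) (auto simp: T_def sum_coloring_def)
      then show False using * by (auto simp: T_def doubleton_eq_iff)
    qed
    then have "card T * (card T - 1 - 0) \<le> M"
      by (intro weak_sidon_card_bound[OF M(1) T ws]) auto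
    moreover have "card T = q - 1" using True S by (simp add: T_def)
    ultimately show False using M(2) unfolding j by (simp add: algebra_simps)
  qed
qed

section \<open>Assembling the colouring of the complete graph on \<open>(l + 2) ^ k\<close>
  vertices\<close>

theorem theorem3:
  fixes q l k n :: nat
  assumes "q \<ge> 8"
    and "q mod 4 = 0 \<or> q mod 4 = 1"
    and "l = q choose 2"
    and "k \<ge> 1"
    and "n = (l + 2) ^ k"
  shows "\<exists>c :: nat set \<Rightarrow> nat.
           completely_balanced {..<n} {..<l + 1} c \<and> \<not> has_rainbow_clique {..<n} c q"
proof -
  have l2: "2 * l = q * (q - 1)"
  proof -
    have "even (q * (q - 1))" by (cases q) auto
    then show ?thesis using assms(3) by (simp add: choose_two)
  qed
  \<comment> \<open>The residue of \<open>q\<close> modulo 4 makes \<open>l\<close> even, so the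
    modulus \<open>l + 1\<close> is odd, as the one-factorization requires.\<close>
  have "4 dvd q * (q - 1)"
    using assms(2)
  proof
    assume "q mod 4 = 1"
    then have "4 dvd q - 1" using mod_eq_dvd_iff_nat[of 1 q 4] \<open>q \<ge> 8\<close> by simp
    then show ?thesis by simp
  qed auto
  then have "even l" unfolding l2[symmetric] by presburger
  then have M: "odd (l + 1)" by simp
  have no: "\<not> rainbow_on (sum_coloring (l + 1)) S"
    if "S \<subseteq> {..<l + 1 + 1}" "card S = q" "finite S" for S
    using no_rainbow_sum_coloring[of q "l + 1" S] that M l2 \<open>q \<ge> 8\<close> by simp
  obtain d f where "(l + 1 + 1) ^ k = (l + 1) * d + 1"
    and "regular_coloring ((l + 1 + 1) ^ k) (l + 1) d f"
    and "\<forall>S. S \<subseteq> {..<(l + 1 + 1) ^ k} \<longrightarrow> card S = q \<longrightarrow> finite S \<longrightarrow> \<not> rainbow_on f S"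
    using regular_coloring_power[OF regular_sum_coloring[OF M], of q k] no \<open>q \<ge> 8\<close> by auto
  moreover have "n = (l + 1 + 1) ^ k" using assms(5) by simp
  ultimately show ?thesis
    using completely_balanced_of_regular_coloring[of n "l + 1" d f q] by auto
qed

end
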